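(* Consider a stochastic depletion problem with deterministic (known) statistics $P_t(A)$ and optimal value function $J^*$. Let $\alpha>0$ and let $\pi^{\rm approx}:\mathcal S\to\mathcal A$ be a policy such that for all $s\in\mathcal S$ (with $t(s)<T$) $$E[R(s,\pi^{\rm approx}(s))]\ge\frac1\alpha\max_{A\in\mathcal A}E[R(s,A)].$$ Assume that $J^*$ satisfies the following two properties. (Value Function Monotonicity) For all states $s,s'\in\mathcal S$ with $x(s)\ge x(s')$ and $t(s)=t(s')$, one has $J^*(s)\ge J^*(s')$. (Immediate Rewards) For all $\bar s\in\mathcal S$ and all $\beta\in\prod_{m=1}^M\{0,1,\dots,x(\bar s)_m\}$, $$J^*(\bar s)\le g\big(x(\bar s),x(\bar s)-\beta,t(\bar s)\big)+J^*\big(\tilde S_\beta(\bar s)\big).$$ Then for all $s\in\mathcal S$, $$J^*(s)\le(1+\alpha)\,J^{\pi^{\rm approx}}(s).$$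
   Context: Stochastic depletion problem (clairvoyant form). There are $M$ item types, with at most $\bar x_m\in\mathbb Z_+$ items of type $m$; a finite nonempty set $\mathcal A$ of activities; and a horizon $T$ (a positive integer). For each $A\in\mathcal A$ there is a fixed known sequence $P_t(A)$, $t=0,1,2,\dots$, with values in a compact set $\mathcal R$. The state space is $\mathcal S=\{(x,t): x\in\prod_{m}\{0,1,\dots,\bar x_m\},\ t\in\{0,1,\dots,T\}\}$; for $s=(x,t)$ write $x(s)=x$, $t(s)=t$. Vector inequalities are componentwise. If activity $A$ is used in state $s=(x,t)$ with $t<T$, a random vector $X_t$ with values in $\prod_m\{0,\dots,x_m\}$ of items is depleted; its law is determined by $x$ and the sufficient statistic $P_t(A)$, and given these it is independent of the past. The next state is $(x-X_t,t+1)$ and the reward earned is $R(s,A)=g(x,x-X_t,t)$, where $g:\mathbb Z_+^M\times\mathbb Z_+^M\times\{0,\dots,T\}\to\mathbb R_+$ is non-negative, $g(x,x',\cdot)$ is non-increasing in time for all $x,x'$, and $g(x,x',T)=0$ for all $x,x'$. A policy is a map $\pi:\mathcal S\to\mathcal A$. Its reward-to-go is $J^\pi(s)=E\big[\sum_{t'=t(s)}^{T-1}R(S_{t'},\pi(S_{t'}))\mid S_{t(s)}=s\big]$, where $S_t$ is the state at time $t$ under $\pi$, and $J^*(s)=\max_\pi J^\pi(s)$. For $\beta\in\mathbb Z_+^M$, $\tilde S_\beta(s)$ is the state $s'$ with $t(s')=t(s)$ and $x(s')_m=\max(x(s)_m-\beta_m,0)$ for all $m$. *)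

theory Defs
  imports "HOL-Probability.Probability"
begin

text \<open>
  The finite type \<^typ>\<open>'m\<close> is the set of item types, so that item vectors are functions
  \<^typ>\<open>'m \<Rightarrow> nat\<close> with the pointwise order and the pointwise (truncated) difference.
  A state is a pair of a vector of remaining items and a time.
\<close>

type_synonym 'm state = "('m \<Rightarrow> nat) \<times> nat"

text \<open>
  \<open>law d x p\<close> is the distribution of the depleted items when the remaining items are \<open>x\<close> and the
  activity in use has statistic \<open>p\<close>; \<open>gain\<close> is the function \<open>g(x, x', t)\<close> determining the rewards.
\<close>

record ('m, 'a, 'p) depletion =
  capacity   :: "'m \<Rightarrow> nat"
  activities :: "'a set"
  horizon    :: nat
  stat_space :: "'p set"
  stat       :: "nat \<Rightarrow> 'a \<Rightarrow> 'p"
  law        :: "('m \<Rightarrow> nat) \<Rightarrow> 'p \<Rightarrow> ('m \<Rightarrow> nat) pmf"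
  gain       :: "('m \<Rightarrow> nat) \<Rightarrow> ('m \<Rightarrow> nat) \<Rightarrow> nat \<Rightarrow> real"

locale stochastic_depletion =
  fixes d :: "('m::finite, 'a, 'p::topological_space) depletion"
  assumes finite_activities: "finite (activities d)"
    and activities_nonempty: "activities d \<noteq> {}"
    and horizon_pos: "0 < horizon d"
    and compact_stat_space: "compact (stat_space d)"
    and stat_in_space: "A \<in> activities d \<Longrightarrow> stat d t A \<in> stat_space d"
    and depleted_le: "x \<le> capacity d \<Longrightarrow> p \<in> stat_space d \<Longrightarrow> X \<in> set_pmf (law d x p) \<Longrightarrow> X \<le> x"
    and gain_nonneg: "t \<le> horizon d \<Longrightarrow> 0 \<le> gain d x x' t"
    and gain_antimono: "t \<le> t' \<Longrightarrow> t' \<le> horizon d \<Longrightarrow> gain d x x' t' \<le> gain d x x' t"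
    and gain_horizon: "gain d x x' (horizon d) = 0"

definition states :: "('m, 'a, 'p) depletion \<Rightarrow> 'm state set" where
  "states d = {(x, t). x \<le> capacity d \<and> t \<le> horizon d}"

definition policies :: "('m, 'a, 'p) depletion \<Rightarrow> ('m state \<Rightarrow> 'a) set" where
  "policies d = states d \<rightarrow>\<^sub>E activities d"

definition transition :: "('m, 'a, 'p) depletion \<Rightarrow> 'm state \<Rightarrow> 'a \<Rightarrow> 'm state pmf" where
  "transition d s A = (case s of (x, t) \<Rightarrow>
     map_pmf (\<lambda>X. (x - X, Suc t)) (law d x (stat d t A)))"

text \<open>The reward earned on moving from \<open>s\<close> to \<open>s'\<close>; \<open>R(s, A)\<close> is this with \<open>s'\<close> random.\<close>

definition reward :: "('m, 'a, 'p) depletion \<Rightarrow> 'm state \<Rightarrow> 'm state \<Rightarrow> real" where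
  "reward d s s' = gain d (fst s) (fst s') (snd s)"

definition expected_reward :: "('m, 'a, 'p) depletion \<Rightarrow> 'm state \<Rightarrow> 'a \<Rightarrow> real" where
  "expected_reward d s A = measure_pmf.expectation (transition d s A) (reward d s)"

text \<open>
  The joint law of the first \<open>n + 1\<close> states \<open>[s, S\<^sub>1, \<dots>, S\<^sub>n]\<close> of the Markov chain
  started in \<open>s\<close> and controlled by \<open>\<pi>\<close>.
\<close>

primrec trajectory ::
  "('m, 'a, 'p) depletion \<Rightarrow> ('m state \<Rightarrow> 'a) \<Rightarrow> nat \<Rightarrow> 'm state \<Rightarrow> 'm state list pmf" where
  "trajectory d \<pi> 0 s = return_pmf [s]"
| "trajectory d \<pi> (Suc n) s =
     bind_pmf (transition d s (\<pi> s)) (\<lambda>s'. map_pmf ((#) s) (trajectory d \<pi> n s'))"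

text \<open>Entry \<open>t' - snd s\<close> of a trajectory started in \<open>s\<close> is the state at time \<open>t'\<close>.\<close>

definition reward_to_go :: "('m, 'a, 'p) depletion \<Rightarrow> ('m state \<Rightarrow> 'a) \<Rightarrow> 'm state \<Rightarrow> real" where
  "reward_to_go d \<pi> s =
     measure_pmf.expectation (trajectory d \<pi> (horizon d - snd s) s)
       (\<lambda>\<omega>. \<Sum>t' = snd s..<horizon d. reward d (\<omega> ! (t' - snd s)) (\<omega> ! (Suc t' - snd s)))"

definition optimal_value :: "('m, 'a, 'p) depletion \<Rightarrow> 'm state \<Rightarrow> real" where
  "optimal_value d s = Max ((\<lambda>\<pi>. reward_to_go d \<pi> s) ` policies d)"

text \<open>Subtraction on \<^typ>\<open>nat\<close> truncates, so this is \<open>max (x\<^sub>m - \<beta>\<^sub>m) 0\<close> in each component.\<close>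

definition reduced_state :: "('m \<Rightarrow> nat) \<Rightarrow> 'm state \<Rightarrow> 'm state" where
  "reduced_state \<beta> s = (\<lambda>m. fst s m - \<beta> m, snd s)"

definition value_monotone :: "('m, 'a, 'p) depletion \<Rightarrow> bool" where
  "value_monotone d \<longleftrightarrow>
     (\<forall>s\<in>states d. \<forall>s'\<in>states d. fst s' \<le> fst s \<longrightarrow> snd s = snd s' \<longrightarrow>
        optimal_value d s' \<le> optimal_value d s)"

definition immediate_rewards :: "('m, 'a, 'p) depletion \<Rightarrow> bool" where
  "immediate_rewards d \<longleftrightarrow>
     (\<forall>s\<in>states d. \<forall>\<beta>. \<beta> \<le> fst s \<longrightarrow>
        optimal_value d s
          \<le> gain d (fst s) (fst s - \<beta>) (snd s) + optimal_value d (reduced_state \<beta> s))"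

end

theory Submission
  imports Defs
begin

text \<open>
  The proof is a backward induction on time. At the horizon both values vanish. Before the horizon,
  let \<open>s = (x, t)\<close>, let \<open>\<pi>\<close> be a policy attaining \<open>J*(s)\<close>, and let \<open>A = \<pi> s\<close> and
  \<open>B = \<pi>_approx s\<close>. By the one-step recursion for the reward-to-go and monotonicity of \<open>J*\<close>,
  \<open>J*(s)\<close> is at most \<open>E[R(s, A)] + J*(x, t + 1)\<close>: the items that \<open>A\<close> depletes are
  given back for free. For every outcome \<open>X\<close> of the activity \<open>B\<close>, the immediate rewards property at
  \<open>(x, t + 1)\<close> with \<open>\<beta> = X\<close>, together with the decay of \<open>g\<close> in time, gives
  \<open>J*(x, t + 1) \<le> g(x, x - X, t) + J*(x - X, t + 1)\<close>. Averaging over \<open>X\<close>,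
  \<open>J*(s) \<le> E[R(s, A)] + E[R(s, B)] + E[J*(S)]\<close>, where \<open>S\<close> is the successor of \<open>s\<close> under \<open>B\<close>.
  The first term is at most \<open>\<alpha> E[R(s, B)]\<close> by the choice of \<open>B\<close>, the last one at most
  \<open>(1 + \<alpha>)\<close> times the expected reward-to-go of \<open>\<pi>_approx\<close> from \<open>S\<close> by the induction hypothesis.
  No coupling of the outcomes of \<open>A\<close> and \<open>B\<close> is needed, nor the existence of a policy that is
  optimal in all states at once.
\<close>

section \<open>Finiteness of states, policies and transitions\<close>

context stochastic_depletion
begin

lemma finite_vectors_le: "finite {y :: 'm \<Rightarrow> nat. y \<le> x}"
proof -
  have "{y. y \<le> x} = Pi\<^sub>E UNIV (\<lambda>m. {..x m})"
    by (auto simp: le_fun_def PiE_def extensional_def)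
  then show ?thesis by (simp add: finite_PiE)
qed

lemma finite_states: "finite (states d)"
proof -
  have "states d = {y. y \<le> capacity d} \<times> {..horizon d}"
    by (auto simp: states_def)
  then show ?thesis by (simp add: finite_vectors_le)
qed

lemma finite_policies: "finite (policies d)"
  unfolding policies_def by (intro finite_PiE finite_states finite_activities)

lemma policy_activity: "\<pi> \<in> policies d \<Longrightarrow> s \<in> states d \<Longrightarrow> \<pi> s \<in> activities d"
  by (auto simp: policies_def)

lemma policies_nonempty: "policies d \<noteq> {}"
  unfolding policies_def using activities_nonempty by (simp add: PiE_eq_empty_iff)

lemma successor:
  assumes "s \<in> states d" "snd s < horizon d" "A \<in> activities d"
    and "s' \<in> set_pmf (transition d s A)"
  obtains X where "X \<le> fst s" "s' = (fst s - X, Suc (snd s))"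
proof -
  from assms(4) obtain X
    where X: "X \<in> set_pmf (law d (fst s) (stat d (snd s) A))" "s' = (fst s - X, Suc (snd s))"
    by (auto simp: transition_def split: prod.splits)
  moreover have "X \<le> fst s"
    using depleted_le[OF _ stat_in_space[OF assms(3)] X(1)] assms(1) by (auto simp: states_def)
  ultimately show thesis using that by blast
qed

lemma successor_in_states:
  assumes "s \<in> states d" "snd s < horizon d" "A \<in> activities d"
    and "s' \<in> set_pmf (transition d s A)"
  shows "s' \<in> states d" "snd s' = Suc (snd s)" "fst s' \<le> fst s"
proof -
  obtain X where X: "X \<le> fst s" "s' = (fst s - X, Suc (snd s))"
    using successor[OF assms] .
  show le: "fst s' \<le> fst s" using X by (auto simp: le_fun_def)
  show "snd s' = Suc (snd s)" using X by simp
  moreover have "fst s' \<le> capacity d"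
    using le assms(1) by (auto simp: states_def intro: order_trans)
  ultimately show "s' \<in> states d"
    using assms(2) by (cases s') (auto simp: states_def)
qed

lemma finite_transition:
  assumes "s \<in> states d" "snd s < horizon d" "A \<in> activities d"
  shows "finite (set_pmf (transition d s A))"
  using successor_in_states(1)[OF assms] finite_states by (meson finite_subset subsetI)

section \<open>One-step recursion for the reward-to-go\<close>

lemma nth_0_trajectory: "\<omega> \<in> set_pmf (trajectory d \<pi> n s) \<Longrightarrow> \<omega> ! 0 = s"
  by (cases n) auto

lemma finite_trajectory:
  assumes "\<pi> \<in> policies d" "s \<in> states d" "n \<le> horizon d - snd s"
  shows "finite (set_pmf (trajectory d \<pi> n s))"
  using assms(2,3)
proof (induction n arbitrary: s)
  case (Suc n)
  then have lt: "snd s < horizon d" by simp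
  note act = policy_activity[OF assms(1) Suc.prems(1)]
  have "finite (set_pmf (trajectory d \<pi> n s'))"
    if "s' \<in> set_pmf (transition d s (\<pi> s))" for s'
    using successor_in_states[OF Suc.prems(1) lt act that] Suc by auto
  then show ?case
    using finite_transition[OF Suc.prems(1) lt act] by auto
qed simp

lemma reward_to_go_horizon: "snd s = horizon d \<Longrightarrow> reward_to_go d \<pi> s = 0"
  by (simp add: reward_to_go_def)

text \<open>
  The Markov property of the controlled chain: the first transition splits off the expected reward
  of one period. All laws involved have finite support, so every function is integrable.
\<close>

lemma reward_to_go_step:
  assumes \<pi>: "\<pi> \<in> policies d" and s: "s \<in> states d" and lt: "snd s < horizon d"
  shows "reward_to_go d \<pi> s = expected_reward d s (\<pi> s)
           + measure_pmf.expectation (transition d s (\<pi> s)) (reward_to_go d \<pi>)"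
proof -
  define p where "p = transition d s (\<pi> s)"
  define n where "n = horizon d - Suc (snd s)"
  define h where "h \<sigma> \<omega> = (\<Sum>t = snd \<sigma>..<horizon d.
      reward d (\<omega> ! (t - snd \<sigma>)) (\<omega> ! (Suc t - snd \<sigma>)))"
    for \<sigma> :: "'m state" and \<omega> :: "'m state list"
  note act = policy_activity[OF \<pi> s]
  note succ = successor_in_states[OF s lt act, folded p_def]
  have fin: "finite (set_pmf p)"
    using finite_transition[OF s lt act] by (simp add: p_def)
  have horizon: "horizon d - snd s = Suc n"
    using lt by (simp add: n_def)
  have fin_traj: "finite (set_pmf (trajectory d \<pi> n s'))" if "s' \<in> set_pmf p" for s'
    using succ[OF that] by (intro finite_trajectory \<pi>) (auto simp: n_def)
  have inner: "measure_pmf.expectation (map_pmf ((#) s) (trajectory d \<pi> n s')) (h s)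
      = reward d s s' + reward_to_go d \<pi> s'" if s': "s' \<in> set_pmf p" for s'
  proof -
    have "h s (s # \<omega>) = reward d s s' + h s' \<omega>"
      if "\<omega> \<in> set_pmf (trajectory d \<pi> n s')" for \<omega>
    proof -
      have "h s (s # \<omega>) = reward d s (\<omega> ! 0)
          + (\<Sum>t = Suc (snd s)..<horizon d.
               reward d ((s # \<omega>) ! (t - snd s)) ((s # \<omega>) ! (Suc t - snd s)))"
        unfolding h_def using lt by (subst sum.atLeast_Suc_lessThan) (auto simp: Suc_diff_le)
      also have "(\<Sum>t = Suc (snd s)..<horizon d.
            reward d ((s # \<omega>) ! (t - snd s)) ((s # \<omega>) ! (Suc t - snd s))) = h s' \<omega>"
        unfolding h_def succ(2)[OF s']
        by (intro sum.cong refl) (auto simp: nth_Cons' Suc_diff_le)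
      finally show ?thesis using nth_0_trajectory[OF that] by simp
    qed
    then have "measure_pmf.expectation (trajectory d \<pi> n s') (\<lambda>\<omega>. h s (s # \<omega>))
        = measure_pmf.expectation (trajectory d \<pi> n s') (\<lambda>\<omega>. reward d s s' + h s' \<omega>)"
      by (intro integral_cong_AE) (auto simp: AE_measure_pmf_iff)
    also have "\<dots> = reward d s s' + measure_pmf.expectation (trajectory d \<pi> n s') (h s')"
      by (subst Bochner_Integration.integral_add)
        (auto intro!: integrable_measure_pmf_finite fin_traj s')
    also have "measure_pmf.expectation (trajectory d \<pi> n s') (h s') = reward_to_go d \<pi> s'"
      using succ(2)[OF s'] by (simp add: reward_to_go_def h_def[abs_def] n_def)
    finally show ?thesis by simp
  qed
  have "reward_to_go d \<pi> s
      = measure_pmf.expectation (p \<bind> (\<lambda>s'. map_pmf ((#) s) (trajectory d \<pi> n s'))) (h s)"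
    by (simp add: reward_to_go_def horizon h_def[abs_def] p_def)
  also have "\<dots> = (\<Sum>s'\<in>set_pmf p. pmf p s' *\<^sub>R
      measure_pmf.expectation (map_pmf ((#) s) (trajectory d \<pi> n s')) (h s))"
    using fin fin_traj by (intro pmf_expectation_bind) auto
  also have "\<dots> = (\<Sum>s'\<in>set_pmf p. pmf p s' *\<^sub>R (reward d s s' + reward_to_go d \<pi> s'))"
    by (intro sum.cong refl) (simp only: inner)
  also have "\<dots> = measure_pmf.expectation p (\<lambda>s'. reward d s s' + reward_to_go d \<pi> s')"
    by (rule integral_measure_pmf[symmetric]) (use fin in auto)
  also have "\<dots> = measure_pmf.expectation p (reward d s)
      + measure_pmf.expectation p (reward_to_go d \<pi>)"
    by (intro Bochner_Integration.integral_add integrable_measure_pmf_finite fin)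
  finally show ?thesis by (simp add: expected_reward_def p_def)
qed

section \<open>Bounds on the optimal value over one period\<close>

lemma reward_to_go_le_optimal_value: "\<pi> \<in> policies d \<Longrightarrow> reward_to_go d \<pi> s \<le> optimal_value d s"
  unfolding optimal_value_def by (intro Max_ge) (auto simp: finite_policies)

lemma optimal_value_attained:
  obtains \<pi> where "\<pi> \<in> policies d" "optimal_value d s = reward_to_go d \<pi> s"
proof -
  have "optimal_value d s \<in> (\<lambda>\<pi>. reward_to_go d \<pi> s) ` policies d"
    unfolding optimal_value_def using finite_policies policies_nonempty by (intro Max_in) auto
  then show thesis using that by blast
qed

text \<open>
  Under monotonicity an optimal controller never gains from having depleted items, so one period is
  worth at most the best myopic reward.
\<close>

lemma optimal_value_le_myopic:
  assumes mono: "value_monotone d" and s: "s \<in> states d" and lt: "snd s < horizon d"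
  shows "optimal_value d s
    \<le> Max (expected_reward d s ` activities d) + optimal_value d (fst s, Suc (snd s))"
proof -
  obtain \<pi> where \<pi>: "\<pi> \<in> policies d" and opt: "optimal_value d s = reward_to_go d \<pi> s"
    by (rule optimal_value_attained)
  note act = policy_activity[OF \<pi> s]
  let ?u = "(fst s, Suc (snd s))"
  have u: "?u \<in> states d" using s lt by (auto simp: states_def)
  have "reward_to_go d \<pi> s' \<le> optimal_value d ?u"
    if "s' \<in> set_pmf (transition d s (\<pi> s))" for s'
  proof -
    have "optimal_value d s' \<le> optimal_value d ?u"
      using mono u successor_in_states[OF s lt act that] unfolding value_monotone_def by auto
    then show ?thesis using reward_to_go_le_optimal_value[OF \<pi>] order_trans by blast
  qed
  then have "measure_pmf.expectation (transition d s (\<pi> s)) (reward_to_go d \<pi>)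
      \<le> measure_pmf.expectation (transition d s (\<pi> s)) (\<lambda>_. optimal_value d ?u)"
    by (intro integral_mono_AE integrable_measure_pmf_finite finite_transition s lt act)
      (auto simp: AE_measure_pmf_iff)
  moreover have "expected_reward d s (\<pi> s) \<le> Max (expected_reward d s ` activities d)"
    using finite_activities act by (intro Max_ge) auto
  ultimately show ?thesis
    unfolding opt reward_to_go_step[OF \<pi> s lt] by simp
qed

text \<open>
  Skipping a period without depleting anything is worth at most using any one activity \<open>A\<close> and
  collecting its reward.
\<close>

lemma optimal_value_skip_le:
  assumes imm: "immediate_rewards d" and s: "s \<in> states d" and lt: "snd s < horizon d"
    and A: "A \<in> activities d"
  shows "optimal_value d (fst s, Suc (snd s))
    \<le> expected_reward d s A + measure_pmf.expectation (transition d s A) (optimal_value d)"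
proof -
  let ?u = "(fst s, Suc (snd s))"
  have u: "?u \<in> states d" using s lt by (auto simp: states_def)
  note int = integrable_measure_pmf_finite[OF finite_transition[OF s lt A]]
  have "optimal_value d ?u \<le> reward d s s' + optimal_value d s'"
    if s': "s' \<in> set_pmf (transition d s A)" for s'
  proof -
    obtain X where X: "X \<le> fst s" "s' = (fst s - X, Suc (snd s))"
      using successor[OF s lt A s'] .
    have "reduced_state X ?u = s'"
      using X by (simp add: reduced_state_def fun_diff_def)
    then have "optimal_value d ?u
        \<le> gain d (fst s) (fst s - X) (Suc (snd s)) + optimal_value d s'"
      using imm u X(1) unfolding immediate_rewards_def by fastforce
    also have "gain d (fst s) (fst s - X) (Suc (snd s)) \<le> reward d s s'"
      using gain_antimono[of "snd s" "Suc (snd s)"] lt X(2) by (simp add: reward_def)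
    finally show ?thesis by simp
  qed
  then have "measure_pmf.expectation (transition d s A) (\<lambda>_. optimal_value d ?u)
      \<le> measure_pmf.expectation (transition d s A) (\<lambda>s'. reward d s s' + optimal_value d s')"
    by (intro integral_mono_AE int) (auto simp: AE_measure_pmf_iff)
  also have "\<dots> = expected_reward d s A
      + measure_pmf.expectation (transition d s A) (optimal_value d)"
    unfolding expected_reward_def by (intro Bochner_Integration.integral_add int)
  finally show ?thesis by simp
qed

end

section \<open>The performance bound for approximately myopic policies\<close>

theorem theorem3:
  fixes d :: "('m::finite, 'a, 'p::topological_space) depletion"
    and \<alpha> :: real
    and \<pi>_approx :: "'m state \<Rightarrow> 'a"
  assumes "stochastic_depletion d"
    and "\<alpha> > 0"
    and "\<pi>_approx \<in> policies d"
    and "\<And>s. s \<in> states d \<Longrightarrow> snd s < horizon d \<Longrightarrow>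
           expected_reward d s (\<pi>_approx s) \<ge> 1 / \<alpha> * Max (expected_reward d s ` activities d)"
    and "value_monotone d"
    and "immediate_rewards d"
  shows "\<forall>s\<in>states d. optimal_value d s \<le> (1 + \<alpha>) * reward_to_go d \<pi>_approx s"
proof
  interpret stochastic_depletion d by (rule assms(1))
  note \<pi> = assms(3)
  fix s assume "s \<in> states d"
  then show "optimal_value d s \<le> (1 + \<alpha>) * reward_to_go d \<pi>_approx s"
  proof (induction "horizon d - snd s" arbitrary: s rule: less_induct)
    case less
    note s = less.prems
    have "snd s = horizon d \<or> snd s < horizon d"
      using s by (auto simp: states_def)
    then show ?case
    proof
      assume "snd s = horizon d"
      then show ?thesis
        using reward_to_go_horizon optimal_value_attained by (metis mult_zero_right order_refl)
    next
      assume lt: "snd s < horizon d"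
      note act = policy_activity[OF \<pi> s]
      let ?R = "expected_reward d s (\<pi>_approx s)"
      let ?E = "measure_pmf.expectation (transition d s (\<pi>_approx s))"
      note int = integrable_measure_pmf_finite[OF finite_transition[OF s lt act]]
      have "Max (expected_reward d s ` activities d) \<le> \<alpha> * ?R"
        using assms(4)[OF s lt] \<open>\<alpha> > 0\<close> by (simp add: field_simps)
      moreover have "?E (optimal_value d) \<le> (1 + \<alpha>) * ?E (reward_to_go d \<pi>_approx)"
      proof -
        have "optimal_value d s' \<le> (1 + \<alpha>) * reward_to_go d \<pi>_approx s'"
          if "s' \<in> set_pmf (transition d s (\<pi>_approx s))" for s'
          using successor_in_states[OF s lt act that] lt by (intro less.hyps) auto
        then have "?E (optimal_value d) \<le> ?E (\<lambda>s'. (1 + \<alpha>) * reward_to_go d \<pi>_approx s')"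
          by (intro integral_mono_AE int) (auto simp: AE_measure_pmf_iff)
        then show ?thesis by simp
      qed
      ultimately have "optimal_value d s
          \<le> \<alpha> * ?R + (?R + (1 + \<alpha>) * ?E (reward_to_go d \<pi>_approx))"
        using optimal_value_le_myopic[OF assms(5) s lt]
          optimal_value_skip_le[OF assms(6) s lt act] by linarith
      also have "\<dots> = (1 + \<alpha>) * reward_to_go d \<pi>_approx s"
        unfolding reward_to_go_step[OF \<pi> s lt] by (simp add: algebra_simps)
      finally show ?thesis .
    qed
  qed
qed

end
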